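(* Let $n,p,q$ be positive integers with $n>q$, and let $\pi_{\mathrm{RRG}}$ be the stationary distribution of the restricted random growth model on $\chi^{p,q}$ (with parameter $n$). Then for all $\lambda,\mu\in\chi^{p,q}$, $$\frac{\pi_{\mathrm{RRG}}(\lambda)}{\pi_{\mathrm{RRG}}(\mu)}=\frac{|S_n(\lambda)|}{|S_n(\mu)|}\,u^{|\lambda|-|\mu|}.$$
   Context: Partitions are written as $n$-tuples $(\lambda_1\ge\cdots\ge\lambda_n\ge0)$; $|\lambda|=\sum\lambda_i$, $m_i(\lambda)$ is the number of parts equal to $i$, $\ell(\lambda)$ the number of positive parts; $S_n(\lambda)$ is the set of distinct rearrangements of $(\lambda_1,\dots,\lambda_n)$. $\chi^{p,q}=\{\lambda:\lambda_1\le p,\ \ell(\lambda)=q\}$. Restricted random growth model (parameter $u\in[0,1]$) on $\chi^{p,q}$ with transition probabilities $d^{(n)}_{\nu,\lambda}$ from $\nu$ to $\lambda$: $\frac{m_i(\nu)u}{3n}$ if $\lambda$ is obtained from $\nu$ by changing one part equal to $i$ into $i+1$; $\frac{m_i(\nu)}{3n}$ if $\lambda$ is obtained from $\nu$ by changing one part equal to $i$ into $i-1$; $0$ for other $\lambda\ne\nu$; $d^{(n)}_{\nu,\nu}=1-\sum_{\lambda\ne\nu}d^{(n)}_{\nu,\lambda}$. *)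

theory Defs
  imports "HOL-Probability.Probability" "HOL-Combinatorics.Multiset_Permutations"
begin

text \<open>A partition is a weakly decreasing list of length \<open>n\<close>, padded with zeros. Thus
  \<open>\<bar>lam\<bar>\<close> is \<open>sum_list lam\<close> and \<open>m\<^sub>i(lam)\<close> is \<open>count_list lam i\<close>.\<close>

definition partition_tuple :: "nat \<Rightarrow> nat list \<Rightarrow> bool" where
  "partition_tuple n lam \<longleftrightarrow> length lam = n \<and> sorted_wrt (\<ge>) lam"

definition num_pos_parts :: "nat list \<Rightarrow> nat" where
  "num_pos_parts lam = length (filter (\<lambda>x. x > 0) lam)"

definition chi :: "nat \<Rightarrow> nat \<Rightarrow> nat \<Rightarrow> nat list set" where
  "chi n p q = {lam. partition_tuple n lam \<and> hd lam \<le> p \<and> num_pos_parts lam = q}"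

definition rearrangements :: "nat list \<Rightarrow> nat list set" where
  "rearrangements lam = permutations_of_multiset (mset lam)"

text \<open>The tuple is re-sorted after the change of a part, hence the comparison of multisets.\<close>

definition change_part :: "nat list \<Rightarrow> nat \<Rightarrow> nat \<Rightarrow> nat list \<Rightarrow> bool" where
  "change_part \<nu> i j lam \<longleftrightarrow> i \<in> set \<nu> \<and> mset lam = mset \<nu> - {#i#} + {#j#}"

text \<open>For given \<open>\<nu> \<noteq> lam\<close> at most one summand is non-zero: \<open>\<nu>\<close> and \<open>lam\<close> determine both the
  direction of the change and the part \<open>i\<close> that is changed.\<close>

definition rrg_move :: "nat \<Rightarrow> real \<Rightarrow> nat list \<Rightarrow> nat list \<Rightarrow> real" where
  "rrg_move n u \<nu> lam =
     (\<Sum>i\<in>set \<nu>.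
        (if change_part \<nu> i (i + 1) lam then real (count_list \<nu> i) * u / (3 * real n) else 0) +
        (if i > 0 \<and> change_part \<nu> i (i - 1) lam then real (count_list \<nu> i) / (3 * real n) else 0))"

definition rrg_trans :: "nat \<Rightarrow> nat \<Rightarrow> nat \<Rightarrow> real \<Rightarrow> nat list \<Rightarrow> nat list \<Rightarrow> real" where
  "rrg_trans n p q u \<nu> lam =
     (if lam = \<nu> then 1 - (\<Sum>\<kappa>\<in>chi n p q - {\<nu>}. rrg_move n u \<nu> \<kappa>) else rrg_move n u \<nu> lam)"

definition rrg_stationary :: "nat \<Rightarrow> nat \<Rightarrow> nat \<Rightarrow> real \<Rightarrow> nat list pmf \<Rightarrow> bool" where
  "rrg_stationary n p q u \<pi> \<longleftrightarrow>
     set_pmf \<pi> \<subseteq> chi n p q \<and>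
     (\<forall>lam\<in>chi n p q. (\<Sum>\<nu>\<in>chi n p q. pmf \<pi> \<nu> * rrg_trans n p q u \<nu> lam) = pmf \<pi> lam)"

end

theory Submission imports Defs begin

text \<open>The weight \<open>w(\<lambda>) = |S\<^sub>n(\<lambda>)| u\<^bsup>|\<lambda>|\<^esup>\<close> satisfies detailed balance, so for \<open>u > 0\<close> the
  quotient \<open>\<pi>/w\<close> is harmonic on the finite state space. From any state one can lower parts
  greater than 1 until the bottom state \<open>(1\<^sup>q, 0\<^bsup>n-q\<^esup>)\<close> is reached; hence both the maximum and
  the minimum of \<open>\<pi>/w\<close> are attained there, and \<open>\<pi>/w\<close> is constant. For \<open>u = 0\<close> all moves are
  lowering moves and \<open>\<pi>\<close> is concentrated on the bottom state.\<close>

section \<open>Maximum principle on a finite set\<close>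

lemma harmonic_le_bottom:
  fixes c :: "'a \<Rightarrow> 'a \<Rightarrow> real" and h :: "'a \<Rightarrow> real" and r :: "'a \<Rightarrow> nat"
  assumes fin: "finite X"
    and nonneg: "\<And>x y. 0 \<le> c x y"
    and harmonic: "\<And>x. x \<in> X \<Longrightarrow> (\<Sum>y\<in>X - {x}. c x y * (h y - h x)) = 0"
    and descent: "\<And>x. x \<in> X \<Longrightarrow> x \<noteq> b \<Longrightarrow> \<exists>y\<in>X. r y < r x \<and> 0 < c x y"
    and "x \<in> X"
  shows "h x \<le> h b"
proof -
  have "Max (h ` X) \<in> h ` X"
    using fin \<open>x \<in> X\<close> by (intro Max_in) auto
  then obtain x0 where x0: "x0 \<in> X" "h x0 = Max (h ` X)" by auto
  have le: "h y \<le> h x0" if "y \<in> X" for y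
    using that fin x0 by simp
  have "h z = h x0 \<Longrightarrow> z \<in> X \<Longrightarrow> h b = h x0" for z
  \<comment> \<open>A maximum point other than \<open>b\<close> passes its value to a neighbour of
    smaller rank \<open>r\<close>, so the descent carries the maximum down to
    \<open>b\<close>.\<close>
  proof (induction z rule: measure_induct_rule[where f = r])
    case (less z)
    show ?case
    proof (cases "z = b")
      case False
      then obtain y where y: "y \<in> X" "r y < r z" "0 < c z y"
        using descent less.prems by blast
      \<comment> \<open>At a maximum the negated harmonic sum has only non-negative terms; since
        they add up to 0, \<open>h y = h z\<close> wherever \<open>c z y > 0\<close>.\<close>
      have "\<forall>y\<in>X - {z}. c z y * (h z - h y) = 0"
      proof (subst sum_nonneg_eq_0_iff[symmetric])
        show "(\<Sum>y\<in>X - {z}. c z y * (h z - h y)) = 0"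
          using harmonic[OF less.prems(2)]
          by (simp add: right_diff_distrib sum_subtractf)
      qed (use fin nonneg le less.prems in auto)
      with y have "h y = h z" by force
      then show ?thesis using less y by metis
    qed (use less in simp)
  qed
  from this[OF refl x0(1)] show ?thesis using le \<open>x \<in> X\<close> by simp
qed

section \<open>Single moves\<close>

lemma change_part_iff:
  "change_part \<nu> i j lam \<longleftrightarrow> (\<exists>A. mset \<nu> = add_mset i A \<and> mset lam = add_mset j A)"
  unfolding change_part_def
  by (metis add_mset_add_single add_mset_remove_trivial insert_DiffM set_mset_mset union_single_eq_member)

lemma change_part_commute: "change_part \<nu> i j lam \<longleftrightarrow> change_part lam j i \<nu>"
  by (auto simp: change_part_iff)

lemma change_part_sum_list:
  assumes "change_part \<nu> i j lam"
  shows "sum_list \<nu> + j = sum_list lam + i"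
proof -
  obtain A where "mset \<nu> = add_mset i A" "mset lam = add_mset j A"
    using assms by (auto simp: change_part_iff)
  then show ?thesis by (simp flip: sum_mset_sum_list)
qed

text \<open>A lowering move from \<open>\<nu>\<close> to \<open>lam\<close> is read as a raising
  move from \<open>lam\<close> to \<open>\<nu>\<close>, indexed by the smaller value
  \<open>i\<close>. Exchanging the two states then exchanges the index sets of the two sums, as
  detailed balance requires.\<close>

lemma rrg_move_eq:
  "rrg_move n u \<nu> lam =
     (\<Sum>i | change_part \<nu> i (Suc i) lam. real (count_list \<nu> i) * u / (3 * real n)) +
     (\<Sum>i | change_part lam i (Suc i) \<nu>. real (count_list \<nu> (Suc i)) / (3 * real n))"
proof -
  have up: "{i \<in> set \<nu>. change_part \<nu> i (Suc i) lam} = {i. change_part \<nu> i (Suc i) lam}"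
    by (auto simp: change_part_def)
  have down: "{i \<in> set \<nu>. i > 0 \<and> change_part \<nu> i (i - 1) lam}
      = Suc ` {i. change_part lam i (Suc i) \<nu>}"
  proof (intro set_eqI iffI)
    fix i assume "i \<in> {i \<in> set \<nu>. i > 0 \<and> change_part \<nu> i (i - 1) lam}"
    then show "i \<in> Suc ` {i. change_part lam i (Suc i) \<nu>}"
      by (intro image_eqI[of _ _ "i - 1"]) (auto simp: change_part_commute[of lam])
  next
    fix i assume "i \<in> Suc ` {i. change_part lam i (Suc i) \<nu>}"
    then show "i \<in> {i \<in> set \<nu>. i > 0 \<and> change_part \<nu> i (i - 1) lam}"
      by (auto simp: change_part_commute[of lam]) (auto simp: change_part_def)
  qed
  show ?thesis
    unfolding rrg_move_def sum.distrib
    using down by (simp add: up sum.reindex flip: sum.inter_filter)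
qed

lemma rrg_move_nonneg: "0 \<le> u \<Longrightarrow> 0 \<le> rrg_move n u \<nu> lam"
  unfolding rrg_move_eq by (intro add_nonneg_nonneg sum_nonneg) auto

section \<open>Detailed balance\<close>

lemma card_rearrangements_pos: "0 < card (rearrangements lam)"
  by (auto simp: rearrangements_def card_gt_0_iff permutations_of_multiset_not_empty)

text \<open>Marking one copy of the changed value in a rearrangement amounts to choosing a
  rearrangement of the common remainder \<open>A\<close> and a position for the insertion. That
  number does not depend on the inserted value.\<close>

lemma card_rearrangements_change_part:
  assumes "change_part \<nu> i j lam"
  shows "card (rearrangements \<nu>) * count_list \<nu> i = card (rearrangements lam) * count_list lam j"
proof -
  obtain A where A: "mset \<nu> = add_mset i A" "mset lam = add_mset j A"
    using assms by (auto simp: change_part_iff)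
  have "card (permutations_of_multiset (add_mset k A)) * (count A k + 1)
      = (size A + 1) * card (permutations_of_multiset A)" for k
    using card_permutations_of_multiset_insert_aux[of A k] by simp
  then show ?thesis
    by (simp add: rearrangements_def A flip: count_mset)
qed

definition rrg_weight :: "real \<Rightarrow> nat list \<Rightarrow> real" where
  "rrg_weight u lam = real (card (rearrangements lam)) * u ^ sum_list lam"

lemma rrg_weight_pos: "0 < u \<Longrightarrow> 0 < rrg_weight u lam"
  by (simp add: rrg_weight_def card_rearrangements_pos)

text \<open>The multiplicities balance by the marking argument, and the factor \<open>u\<close> of
  the raising rate makes up for the exponent, which is larger by one at \<open>lam\<close>.\<close>

lemma rrg_weight_up_down:
  assumes "change_part \<nu> i (Suc i) lam"
  shows "rrg_weight u \<nu> * (real (count_list \<nu> i) * u / (3 * real n))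
    = rrg_weight u lam * (real (count_list lam (Suc i)) / (3 * real n))"
proof -
  have "real (card (rearrangements \<nu>)) * real (count_list \<nu> i)
      = real (card (rearrangements lam)) * real (count_list lam (Suc i))"
    using card_rearrangements_change_part[OF assms] by (simp flip: of_nat_mult)
  moreover have "sum_list lam = Suc (sum_list \<nu>)"
    using change_part_sum_list[OF assms] by simp
  ultimately show ?thesis by (simp add: rrg_weight_def)
qed

lemma detailed_balance:
  "rrg_weight u \<nu> * rrg_move n u \<nu> lam = rrg_weight u lam * rrg_move n u lam \<nu>"
proof -
  \<comment> \<open>Kept general in both states: one instance matches the raising sum on the left
    with the lowering sum on the right, the swapped instance does the converse.\<close>
  have "rrg_weight u \<nu> * (\<Sum>i | change_part \<nu> i (Suc i) lam. real (count_list \<nu> i) * u / (3 * real n))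
      = rrg_weight u lam * (\<Sum>i | change_part \<nu> i (Suc i) lam. real (count_list lam (Suc i)) / (3 * real n))"
    for \<nu> lam
    unfolding sum_distrib_left by (intro sum.cong refl rrg_weight_up_down) simp
  from this[of \<nu> lam] this[of lam \<nu>] show ?thesis
    unfolding rrg_move_eq distrib_left by simp
qed

section \<open>The state space and its bottom state\<close>

lemma mem_chi_iff:
  assumes "n > 0"
  shows "lam \<in> chi n p q \<longleftrightarrow> length lam = n \<and> sorted_wrt (\<ge>) lam \<and> (\<forall>x\<in>set lam. x \<le> p) \<and>
    size (filter_mset (\<lambda>x. x > 0) (mset lam)) = q"
  using assms unfolding chi_def partition_tuple_def num_pos_parts_def
  \<comment> \<open>In a decreasing list the head bounds every entry; \<open>n > 0\<close> ensures
    that there is a head.\<close>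
  by (cases lam) (auto simp flip: mset_filter)

lemma finite_chi: "n > 0 \<Longrightarrow> finite (chi n p q)"
  by (rule finite_subset[OF _ finite_lists_length_eq[of "{..p}" n]]) (auto simp: mem_chi_iff)

lemma sorted_desc_mset_unique:
  fixes xs ys :: "nat list"
  assumes "sorted_wrt (\<ge>) xs" "sorted_wrt (\<ge>) ys" "mset xs = mset ys"
  shows "xs = ys"
proof -
  have "sort (rev ys) = rev xs" "sort (rev ys) = rev ys"
    using assms by (auto intro!: properties_for_sort simp: sorted_wrt_rev)
  then have "rev xs = rev ys" by simp
  then show ?thesis by simp
qed

text \<open>No lowering move from this list stays in \<open>chi\<close>: turning a 1 into 0 would
  change the number of positive parts.\<close>

definition chi_bottom :: "nat \<Rightarrow> nat \<Rightarrow> nat list" where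
  "chi_bottom n q = replicate q 1 @ replicate (n - q) 0"

text \<open>With entries 0 and 1 only, the number \<open>q\<close> of positive parts and the length
  \<open>n\<close> fix the multiset, and sortedness then fixes the list.\<close>

lemma eq_chi_bottom:
  assumes "n > 0" "lam \<in> chi n p q" "\<forall>x\<in>set lam. x \<le> 1"
  shows "lam = chi_bottom n q"
proof (rule sorted_desc_mset_unique)
  define A where "A = mset lam"
  have le: "\<forall>x\<in>#A. x = 0 \<or> x = 1" using assms by (auto simp: A_def le_Suc_eq)
  have q: "size (filter_mset (\<lambda>x. x > 0) A) = q" and n: "size A = n"
    using assms by (auto simp: mem_chi_iff A_def)
  have "filter_mset (\<lambda>x. x > 0) A = filter_mset (\<lambda>x. x = 1) A"
    and "filter_mset (\<lambda>x. \<not> x > 0) A = filter_mset (\<lambda>x. x = 0) A"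
    by (rule filter_mset_cong[OF refl]; use le in auto)+
  then have *: "filter_mset (\<lambda>x. x > 0) A = replicate_mset (count A 1) 1"
    "filter_mset (\<lambda>x. \<not> x > 0) A = replicate_mset (count A 0) 0"
    by (simp_all only: filter_eq_replicate_mset)
  have A: "A = replicate_mset (count A 1) 1 + replicate_mset (count A 0) 0"
    using multiset_partition[of A "\<lambda>x. x > 0"] unfolding * .
  have "count A 1 = q" using q unfolding * by simp
  moreover have "count A 0 = n - q"
    using arg_cong[OF A, of size] n \<open>count A 1 = q\<close> by simp
  ultimately have "A = replicate_mset q 1 + replicate_mset (n - q) 0"
    using A by simp
  then show "mset lam = mset (chi_bottom n q)" by (simp add: A_def chi_bottom_def)
  show "sorted_wrt (\<ge>) lam" using assms by (simp add: mem_chi_iff)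
  show "sorted_wrt (\<ge>) (chi_bottom n q)"
    by (auto simp: chi_bottom_def nth_append sorted_wrt_iff_nth_less)
qed

text \<open>Some part exceeds 1. Lowering it by one leaves it positive, so the number of positive
  parts and the bound \<open>p\<close> survive.\<close>

lemma chi_descent:
  assumes "n > 0" "lam \<in> chi n p q" "lam \<noteq> chi_bottom n q"
  obtains i \<kappa> where "\<kappa> \<in> chi n p q" "change_part \<kappa> i (Suc i) lam"
proof -
  obtain x where x: "x \<in> set lam" "x > 1"
    using eq_chi_bottom[OF assms(1,2)] assms(3) by fastforce
  define i where "i = x - 1"
  have i: "x = Suc i" "i > 0" using x by (auto simp: i_def)
  obtain A where A: "mset lam = add_mset (Suc i) A"
    using x i by (metis mset_add set_mset_mset)
  define \<kappa> where "\<kappa> = rev (sorted_list_of_multiset (add_mset i A))"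
  have \<kappa>: "mset \<kappa> = add_mset i A" by (simp add: \<kappa>_def)
  have "sorted_wrt (\<ge>) \<kappa>"
    using sorted_sorted_list_of_multiset[of "add_mset i A"]
    unfolding \<kappa>_def sorted_wrt_rev .
  moreover have "length \<kappa> = n"
    using assms A \<kappa> by (metis mem_chi_iff size_add_mset size_mset)
  moreover have "set lam = insert (Suc i) (set_mset A)" "set \<kappa> = insert i (set_mset A)"
    using A \<kappa> by (metis set_mset_add_mset_insert set_mset_mset)+
  ultimately have "\<kappa> \<in> chi n p q"
    using assms A \<kappa> i by (auto simp: mem_chi_iff)
  moreover have "change_part \<kappa> i (Suc i) lam"
    using A \<kappa> by (auto simp: change_part_iff)
  ultimately show thesis using that by blast
qed

text \<open>The lowering rate carries no factor \<open>u\<close>, so it is positive even for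
  \<open>u = 0\<close>.\<close>

lemma rrg_move_down_pos:
  assumes "n > 0" "0 \<le> u" "change_part \<kappa> i (Suc i) lam"
  shows "0 < rrg_move n u lam \<kappa>"
proof -
  have fin: "finite {i. change_part \<kappa> i (Suc i) lam}"
    by (rule finite_subset[of _ "set \<kappa>"]) (auto simp: change_part_def)
  have "0 < count_list lam (Suc i)"
    using assms(3) unfolding change_part_iff by (auto simp flip: count_mset simp del: count_greater_zero_iff)
  then have "0 < (\<Sum>i | change_part \<kappa> i (Suc i) lam. real (count_list lam (Suc i)) / (3 * real n))"
    using assms fin by (intro sum_pos2[of _ i]) auto
  moreover have "0 \<le> (\<Sum>i | change_part lam i (Suc i) \<kappa>. real (count_list lam i) * u / (3 * real n))"
    using assms by (intro sum_nonneg) auto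
  ultimately show ?thesis unfolding rrg_move_eq by simp
qed

lemma chi_descent_move:
  assumes "n > 0" "0 \<le> u" "lam \<in> chi n p q" "lam \<noteq> chi_bottom n q"
  shows "\<exists>\<kappa>\<in>chi n p q. sum_list \<kappa> < sum_list lam \<and> 0 < rrg_move n u lam \<kappa>"
proof -
  obtain i \<kappa> where \<kappa>: "\<kappa> \<in> chi n p q" "change_part \<kappa> i (Suc i) lam"
    using chi_descent[OF assms(1,3,4)] .
  have "sum_list \<kappa> < sum_list lam"
    using change_part_sum_list[OF \<kappa>(2)] by simp
  with \<kappa> rrg_move_down_pos[OF assms(1,2) \<kappa>(2)] show ?thesis by blast
qed

lemma sum_list_chi_bottom_less:
  assumes "n > 0" "lam \<in> chi n p q" "lam \<noteq> chi_bottom n q"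
  shows "sum_list (chi_bottom n q) < sum_list lam"
  using assms(2,3)
proof (induction lam rule: measure_induct_rule[where f = sum_list])
  case (less lam)
  then obtain \<kappa> where "\<kappa> \<in> chi n p q" "sum_list \<kappa> < sum_list lam"
    \<comment> \<open>\<open>order_refl\<close> instantiates the parameter to \<open>u = 0\<close>;
      only the existence of a smaller state matters here.\<close>
    using chi_descent_move[OF \<open>n > 0\<close> order_refl] by blast
  with less.IH[of \<kappa>] show ?case by (cases "\<kappa> = chi_bottom n q") auto
qed

section \<open>Stationary distributions\<close>

lemma stationary_balance:
  assumes "n > 0" "rrg_stationary n p q u \<pi>" "lam \<in> chi n p q"
  shows "(\<Sum>\<nu>\<in>chi n p q - {lam}. pmf \<pi> \<nu> * rrg_move n u \<nu> lam)
    = pmf \<pi> lam * (\<Sum>\<kappa>\<in>chi n p q - {lam}. rrg_move n u lam \<kappa>)"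
proof -
  have "pmf \<pi> lam = (\<Sum>\<nu>\<in>chi n p q. pmf \<pi> \<nu> * rrg_trans n p q u \<nu> lam)"
    using assms by (simp add: rrg_stationary_def)
  also have "\<dots> = pmf \<pi> lam * rrg_trans n p q u lam lam
      + (\<Sum>\<nu>\<in>chi n p q - {lam}. pmf \<pi> \<nu> * rrg_trans n p q u \<nu> lam)"
    using assms by (simp add: sum.remove finite_chi)
  also have "(\<Sum>\<nu>\<in>chi n p q - {lam}. pmf \<pi> \<nu> * rrg_trans n p q u \<nu> lam)
      = (\<Sum>\<nu>\<in>chi n p q - {lam}. pmf \<pi> \<nu> * rrg_move n u \<nu> lam)"
    by (intro sum.cong) (auto simp: rrg_trans_def)
  \<comment> \<open>The diagonal entry is 1 minus the total exit rate: the 1 cancels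
    \<open>pmf \<pi> lam\<close>, and inflow equals outflow remains.\<close>
  finally show ?thesis by (simp add: rrg_trans_def algebra_simps)
qed

lemma stationary_ratio_const:
  assumes "n > 0" "0 < u" "rrg_stationary n p q u \<pi>" "lam \<in> chi n p q"
  shows "pmf \<pi> lam / rrg_weight u lam
    = pmf \<pi> (chi_bottom n q) / rrg_weight u (chi_bottom n q)"
proof -
  define h where "h x = pmf \<pi> x / rrg_weight u x" for x
  note w = rrg_weight_pos[OF \<open>0 < u\<close>]
  have harmonic: "(\<Sum>y\<in>chi n p q - {x}. rrg_move n u x y * (h y - h x)) = 0"
    if "x \<in> chi n p q" for x
  proof -
    \<comment> \<open>Detailed balance turns the inflow from \<open>y\<close> into the exit rate
      towards \<open>y\<close> times \<open>h y\<close>, so the balance equation becomes harmonicity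
      of \<open>h\<close> for the exit rates.\<close>
    have "pmf \<pi> y * rrg_move n u y x = rrg_weight u x * (rrg_move n u x y * h y)" for y
    proof -
      have "pmf \<pi> y * rrg_move n u y x = h y * (rrg_weight u y * rrg_move n u y x)"
        using w[of y] by (simp add: h_def)
      also have "\<dots> = h y * (rrg_weight u x * rrg_move n u x y)"
        by (simp only: detailed_balance)
      finally show ?thesis by simp
    qed
    moreover have "pmf \<pi> x = rrg_weight u x * h x"
      using w[of x] by (simp add: h_def)
    ultimately have "rrg_weight u x * (\<Sum>y\<in>chi n p q - {x}. rrg_move n u x y * h y)
        = rrg_weight u x * (\<Sum>y\<in>chi n p q - {x}. rrg_move n u x y * h x)"
      using stationary_balance[OF assms(1,3) that]
      by (simp add: sum_distrib_left sum_distrib_right mult_ac)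
    then show ?thesis
      using w[of x] by (simp add: right_diff_distrib sum_subtractf)
  qed
  have "h lam \<le> h (chi_bottom n q)"
    by (rule harmonic_le_bottom[OF finite_chi _ harmonic chi_descent_move])
       (use assms in \<open>auto intro: rrg_move_nonneg\<close>)
  \<comment> \<open>The negative of \<open>h\<close> is harmonic too, so the minimum of
    \<open>h\<close> is also attained at the bottom.\<close>
  moreover have "- h lam \<le> - h (chi_bottom n q)"
  proof (rule harmonic_le_bottom[where h = "\<lambda>x. - h x", OF finite_chi _ _ chi_descent_move])
    show "(\<Sum>y\<in>chi n p q - {x}. rrg_move n u x y * (- h y - - h x)) = 0"
      if "x \<in> chi n p q" for x
      using harmonic[OF that] by (simp add: right_diff_distrib sum_subtractf)
  qed (use assms in \<open>auto intro: rrg_move_nonneg\<close>)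
  ultimately show ?thesis by (simp add: h_def)
qed

text \<open>Some state has positive mass, and the constant ratio to the positive weight spreads this
  to all states. This permits division by \<open>pmf \<pi> \<mu>\<close>.\<close>

lemma stationary_pos:
  assumes "n > 0" "0 < u" "rrg_stationary n p q u \<pi>" "lam \<in> chi n p q"
  shows "0 < pmf \<pi> lam"
proof -
  obtain x where x: "x \<in> set_pmf \<pi>" using set_pmf_not_empty by fast
  then have "x \<in> chi n p q" using assms by (auto simp: rrg_stationary_def)
  then have "pmf \<pi> lam / rrg_weight u lam = pmf \<pi> x / rrg_weight u x"
    using stationary_ratio_const[OF assms(1-3)] assms(4) by simp
  also have "\<dots> > 0" using x rrg_weight_pos[OF assms(2)] by (simp add: pmf_positive)
  finally show ?thesis using rrg_weight_pos[OF assms(2), of lam] by (simp add: zero_less_divide_iff)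
qed

text \<open>Among the non-bottom states of non-zero mass take one with the largest sum. Without
  raising moves, inflow could only come from larger states, which carry no mass; yet its outflow is
  positive.\<close>

lemma stationary_zero:
  assumes "n > 0" "rrg_stationary n p q 0 \<pi>" "lam \<in> chi n p q" "lam \<noteq> chi_bottom n q"
  shows "pmf \<pi> lam = 0"
proof (rule ccontr)
  define S where "S = {x \<in> chi n p q. x \<noteq> chi_bottom n q \<and> pmf \<pi> x \<noteq> 0}"
  assume "pmf \<pi> lam \<noteq> 0"
  then have "finite S" "S \<noteq> {}" using assms by (auto simp: S_def finite_chi)
  then have "Max (sum_list ` S) \<in> sum_list ` S" by simp
  then obtain x where x: "x \<in> S" "sum_list x = Max (sum_list ` S)" by auto
  have max: "sum_list y \<le> sum_list x" if "y \<in> S" for y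
    using that \<open>finite S\<close> x(2) by simp
  have x': "x \<in> chi n p q" "x \<noteq> chi_bottom n q" "pmf \<pi> x \<noteq> 0" using x by (auto simp: S_def)
  have "pmf \<pi> \<nu> * rrg_move n 0 \<nu> x = 0" if "\<nu> \<in> chi n p q" for \<nu>
  proof (rule ccontr)
    assume *: "pmf \<pi> \<nu> * rrg_move n 0 \<nu> x \<noteq> 0"
    then obtain i where "change_part x i (Suc i) \<nu>"
      by (auto simp: rrg_move_eq elim: sum.not_neutral_contains_not_neutral)
    then have less: "sum_list x < sum_list \<nu>" using change_part_sum_list[of x i "Suc i" \<nu>] by simp
    then have "\<nu> \<noteq> chi_bottom n q"
      using sum_list_chi_bottom_less[OF assms(1) x'(1,2)] by auto
    then show False using max[of \<nu>] less * that by (auto simp: S_def)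
  qed
  then have "(\<Sum>\<nu>\<in>chi n p q - {x}. pmf \<pi> \<nu> * rrg_move n 0 \<nu> x) = 0"
    by (intro sum.neutral) blast
  then have "(\<Sum>\<kappa>\<in>chi n p q - {x}. rrg_move n 0 x \<kappa>) = 0"
    using stationary_balance[OF assms(1,2) x'(1)] x'(3) by simp
  moreover obtain \<kappa> where "\<kappa> \<in> chi n p q" "sum_list \<kappa> < sum_list x" "0 < rrg_move n 0 x \<kappa>"
    using chi_descent_move[OF assms(1) order_refl x'(1,2)] by blast
  then have "0 < (\<Sum>\<kappa>\<in>chi n p q - {x}. rrg_move n 0 x \<kappa>)"
    using assms(1) by (intro sum_pos2[of _ \<kappa>]) (auto simp: finite_chi intro: rrg_move_nonneg)
  ultimately show False by simp
qed

theorem theorem3p6: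
  fixes n p q :: nat and u :: real and \<pi> :: "nat list pmf" and lam \<mu> :: "nat list"
  assumes "n > 0" "p > 0" "q > 0" "n > q"
    and "0 \<le> u" "u \<le> 1"
    and "rrg_stationary n p q u \<pi>"
    and "lam \<in> chi n p q" "\<mu> \<in> chi n p q"
    and "u \<noteq> 0 \<or> pmf \<pi> \<mu> \<noteq> 0"
  shows "pmf \<pi> lam / pmf \<pi> \<mu> =
    real (card (rearrangements lam)) / real (card (rearrangements \<mu>))
      * u powi (int (sum_list lam) - int (sum_list \<mu>))"
proof (cases "u = 0")
  case True
  then have zero: "x \<in> chi n p q \<Longrightarrow> x \<noteq> chi_bottom n q \<Longrightarrow> pmf \<pi> x = 0" for x
    using stationary_zero assms(1,7) by blast
  \<comment> \<open>For \<open>u = 0\<close> the non-zero denominator forces \<open>\<mu>\<close> to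
    be the bottom state. The exponent is then never negative: it is 0 for
    \<open>lam = \<mu>\<close>, where \<open>0 powi 0 = 1\<close>, and positive otherwise, where
    both sides vanish.\<close>
  have \<mu>: "\<mu> = chi_bottom n q" "pmf \<pi> \<mu> \<noteq> 0"
    using zero[OF assms(9)] assms(10) True by auto
  show ?thesis
  proof (cases "lam = chi_bottom n q")
    case True
    then show ?thesis using \<mu> card_rearrangements_pos[of \<mu>] by simp
  next
    case False
    then have "pmf \<pi> lam = 0" "sum_list \<mu> < sum_list lam"
      using zero[OF assms(8)] sum_list_chi_bottom_less[OF assms(1,8)] \<mu> by auto
    then show ?thesis using True by (simp add: power_int_0_left_if)
  qed
next
  case False
  then have u: "0 < u" using assms by simp
  have "pmf \<pi> lam / rrg_weight u lam = pmf \<pi> \<mu> / rrg_weight u \<mu>"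
    using stationary_ratio_const[OF assms(1) u assms(7)] assms(8,9) by simp
  then have "pmf \<pi> lam / pmf \<pi> \<mu> = rrg_weight u lam / rrg_weight u \<mu>"
    using stationary_pos[OF assms(1) u assms(7,9)] rrg_weight_pos[OF u, of lam]
      rrg_weight_pos[OF u, of \<mu>] by (simp add: field_simps)
  also have "\<dots> = real (card (rearrangements lam)) / real (card (rearrangements \<mu>))
      * u powi (int (sum_list lam) - int (sum_list \<mu>))"
    using u by (simp add: rrg_weight_def power_int_diff)
  finally show ?thesis .
qed

end
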